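(* There exists an absolute constant $C>0$ such that the following holds. For all integers $n\geq 3$ and $m\geq n$ and all probability distributions $\mathcal D_1,\dots,\mathcal D_m$ on $[0,\infty)$, if the processing times $t_{ij}$ ($i\in\{1,\dots,n\}$, $j\in\{1,\dots,m\}$) are independent with $t_{ij}\sim\mathcal D_j$ for every machine $i$, then $$\mathbb E[\mathrm{VCG}(\mathbf t)]\leq C\,\frac{\ln n}{\ln\ln n}\,\mathbb E[\mathrm{OPT}(\mathbf t)].$$ That is, VCG is $O\left(\frac{\ln n}{\ln\ln n}\right)$-approximate for the Bayesian scheduling problem with $n$ (a priori) identical machines.
   Context: There are $n$ machines and $m\ge n$ tasks; $t_{ij}\ge 0$ is the processing time of task $j$ on machine $i$, and $\mathbf t=(t_{ij})$. In the Bayesian scheduling problem the $t_{ij}$ are independent random variables; machines are (a priori) identical when, for each task $j$, all of $t_{1j},\dots,t_{nj}$ follow the same distribution $\mathcal D_j$ (which may depend on $j$). The VCG allocation assigns each task $j$ to a machine $i$ with $t_{ij}=\min_{i'}t_{i'j}$, ties being broken uniformly at random among the minimizing machines, independently for each task. With $\alpha_{ij}\in\{0,1\}$ indicating whether VCG assigns task $j$ to machine $i$, $\mathrm{VCG}(\mathbf t)=\max_i\sum_{j=1}^m\alpha_{ij}t_{ij}$ is its makespan. $\mathrm{OPT}(\mathbf t)$ is the minimum, over all assignments $a:\{1,\dots,m\}\to\{1,\dots,n\}$ of tasks to machines, of the makespan $\max_i\sum_{j:a(j)=i}t_{ij}$. Expectations are over $\mathbf t$ and the tie-breaking. *)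

theory Defs
  imports "HOL-Probability.Probability"
begin

text \<open>
  Machines are the elements of \<open>{..<n}\<close>, tasks those of \<open>{..<m}\<close>, and \<open>t (i, j)\<close> is the processing
  time of task \<open>j\<close> on machine \<open>i\<close>. An assignment maps tasks to machines; \<open>a j = i\<close> plays the role of
  the indicator \<open>\<alpha>\<^sub>i\<^sub>j = 1\<close>. All quantities are intended for \<open>n > 0\<close>, where every \<open>Min\<close> and \<open>Max\<close>
  below ranges over a finite nonempty set.
\<close>

definition makespan :: "nat \<Rightarrow> nat \<Rightarrow> (nat \<times> nat \<Rightarrow> real) \<Rightarrow> (nat \<Rightarrow> nat) \<Rightarrow> real" where
  "makespan n m t a = Max ((\<lambda>i. \<Sum>j | j < m \<and> a j = i. t (i, j)) ` {..<n})"

definition opt_makespan :: "nat \<Rightarrow> nat \<Rightarrow> (nat \<times> nat \<Rightarrow> real) \<Rightarrow> real" where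
  "opt_makespan n m t = Min (makespan n m t ` ({..<m} \<rightarrow>\<^sub>E {..<n}))"

definition fastest_machines :: "nat \<Rightarrow> (nat \<times> nat \<Rightarrow> real) \<Rightarrow> nat \<Rightarrow> nat set" where
  "fastest_machines n t j = {i. i < n \<and> t (i, j) = Min ((\<lambda>i'. t (i', j)) ` {..<n})}"

text \<open>The random allocation for a fixed time matrix; the only randomness is the tie-breaking.\<close>

definition vcg_allocation :: "nat \<Rightarrow> nat \<Rightarrow> (nat \<times> nat \<Rightarrow> real) \<Rightarrow> (nat \<Rightarrow> nat) pmf" where
  "vcg_allocation n m t = Pi_pmf {..<m} undefined (\<lambda>j. pmf_of_set (fastest_machines n t j))"

text \<open>
  The joint law of independent processing times where each \<open>t (i, j)\<close> has distribution \<open>D j\<close>,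
  as a measure on the (extensional) matrices indexed by \<open>{..<n} \<times> {..<m}\<close>.
\<close>

definition times_law :: "nat \<Rightarrow> nat \<Rightarrow> (nat \<Rightarrow> real measure) \<Rightarrow> (nat \<times> nat \<Rightarrow> real) measure" where
  "times_law n m D = (\<Pi>\<^sub>M p\<in>{..<n} \<times> {..<m}. D (snd p))"

text \<open>
  Expectations live in \<^typ>\<open>ennreal\<close>, so that they exist (and may be \<open>\<infinity>\<close>) without integrability
  assumptions; the coercion \<^const>\<open>ennreal\<close> is harmless since the times are almost surely nonnegative.
\<close>

definition expected_vcg :: "nat \<Rightarrow> nat \<Rightarrow> (nat \<times> nat \<Rightarrow> real) measure \<Rightarrow> ennreal" where
  "expected_vcg n m P =
     (\<integral>\<^sup>+ t. (\<integral>\<^sup>+ a. ennreal (makespan n m t a) \<partial>measure_pmf (vcg_allocation n m t)) \<partial>P)"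

definition expected_opt :: "nat \<Rightarrow> nat \<Rightarrow> (nat \<times> nat \<Rightarrow> real) measure \<Rightarrow> ennreal" where
  "expected_opt n m P = (\<integral>\<^sup>+ t. ennreal (opt_makespan n m t) \<partial>P)"

lemma fastest_machines_finite: "finite (fastest_machines n t j)"
  by (simp add: fastest_machines_def)

lemma fastest_machines_nonempty:
  assumes "n > 0"
  shows "fastest_machines n t j \<noteq> {}"
proof -
  have "Min ((\<lambda>i'. t (i', j)) ` {..<n}) \<in> (\<lambda>i'. t (i', j)) ` {..<n}"
    using assms by (intro Min_in) auto
  then show ?thesis by (force simp: fastest_machines_def)
qed

lemma vcg_inner_eq_sum:
  assumes "n > 0"
  shows "(\<integral>\<^sup>+ a. ennreal (makespan n m t a) \<partial>measure_pmf (vcg_allocation n m t)) =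
    (\<Sum>a\<in>{..<m} \<rightarrow>\<^sub>E {..<n}. ennreal (makespan n m t a) *
       ennreal (\<Prod>j<m. indicator (fastest_machines n t j) (a j) / real (card (fastest_machines n t j))))"
proof -
  have "set_pmf (vcg_allocation n m t) \<subseteq> {..<m} \<rightarrow>\<^sub>E {..<n}"
    using fastest_machines_nonempty[OF assms] fastest_machines_finite
    by (auto simp: vcg_allocation_def set_Pi_pmf PiE_dflt_def PiE_def Pi_def extensional_def
          fastest_machines_def)
  then have "(\<integral>\<^sup>+ a. ennreal (makespan n m t a) \<partial>measure_pmf (vcg_allocation n m t)) =
    (\<Sum>a\<in>{..<m} \<rightarrow>\<^sub>E {..<n}. ennreal (makespan n m t a) * ennreal (pmf (vcg_allocation n m t) a))"
    by (intro nn_integral_measure_pmf_support)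
       (auto simp: finite_PiE set_pmf_iff)
  also have "\<dots> = (\<Sum>a\<in>{..<m} \<rightarrow>\<^sub>E {..<n}. ennreal (makespan n m t a) *
       ennreal (\<Prod>j<m. indicator (fastest_machines n t j) (a j) / real (card (fastest_machines n t j))))"
    using fastest_machines_nonempty[OF assms] fastest_machines_finite
    by (intro sum.cong refl)
       (auto simp: vcg_allocation_def pmf_Pi PiE_def extensional_def pmf_of_set)
  finally show ?thesis .
qed

lemma measurable_makespan:
  "(\<lambda>t. makespan n m t a) \<in> borel_measurable (\<Pi>\<^sub>M p\<in>{..<n} \<times> {..<m}. borel)"
  unfolding makespan_def
  by (intro borel_measurable_Max finite_lessThan borel_measurable_sum measurable_component_singleton) auto

lemma measurable_opt_makespan:
  "opt_makespan n m \<in> borel_measurable (\<Pi>\<^sub>M p\<in>{..<n} \<times> {..<m}. borel)"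
  unfolding opt_makespan_def
  by (intro borel_measurable_Min finite_PiE finite_lessThan measurable_makespan)

lemma measurable_vcg_inner:
  assumes "n > 0"
  shows "(\<lambda>t. \<integral>\<^sup>+ a. ennreal (makespan n m t a) \<partial>measure_pmf (vcg_allocation n m t))
    \<in> borel_measurable (\<Pi>\<^sub>M p\<in>{..<n} \<times> {..<m}. borel)" (is "_ \<in> borel_measurable ?B")
proof -
  have mem: "Measurable.pred ?B (\<lambda>t. i \<in> fastest_machines n t j)" if "j < m" for i j
  proof (cases "i < n")
    case True
    then have 1: "(\<lambda>t. t (i, j)) \<in> borel_measurable ?B"
      using that by (intro measurable_component_singleton) auto
    have 2: "(\<lambda>t. Min ((\<lambda>i'. t (i', j)) ` {..<n})) \<in> borel_measurable ?B"
      using that by (intro borel_measurable_Min finite_lessThan measurable_component_singleton) auto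
    show ?thesis using True borel_measurable_eq[OF 1 2] by (simp add: fastest_machines_def pred_def)
  qed (simp add: fastest_machines_def)
  have card: "(\<lambda>t. real (card (fastest_machines n t j))) \<in> borel_measurable ?B" if "j < m" for j
  proof -
    have eq: "real (card (fastest_machines n t j)) = (\<Sum>i<n. of_bool (i \<in> fastest_machines n t j))" for t
      by (auto simp: fastest_machines_def sum.If_cases of_bool_def Int_def)
    note [measurable] = mem[OF that]
    show ?thesis unfolding eq by measurable
  qed
  have ind: "(\<lambda>t. indicator (fastest_machines n t j) i :: real) \<in> borel_measurable ?B"
    if "j < m" for i j
    using mem[OF that, measurable] unfolding indicator_def by measurable
  show ?thesis
    unfolding vcg_inner_eq_sum[OF assms]
    by (intro borel_measurable_sum borel_measurable_times_ennreal measurable_compose[OF _ measurable_ennreal]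
          borel_measurable_prod borel_measurable_divide measurable_makespan card ind) auto
qed

lemma (in prob_space) times_law_distr:
  assumes "n > 0" "m > 0"
    and "indep_vars (\<lambda>_. borel) t ({..<n} \<times> {..<m})"
    and D: "\<And>i j. i < n \<Longrightarrow> j < m \<Longrightarrow> distr M borel (t (i, j)) = D j"
  shows "times_law n m D =
    distr M (\<Pi>\<^sub>M p\<in>{..<n} \<times> {..<m}. borel) (\<lambda>\<omega>. \<lambda>p\<in>{..<n} \<times> {..<m}. t p \<omega>)"
proof -
  have "random_variable borel (t p)" if "p \<in> {..<n} \<times> {..<m}" for p
    using assms(3) that by (auto simp: indep_vars_def)
  then have "distr M (\<Pi>\<^sub>M p\<in>{..<n} \<times> {..<m}. borel) (\<lambda>\<omega>. \<lambda>p\<in>{..<n} \<times> {..<m}. t p \<omega>) =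
      (\<Pi>\<^sub>M p\<in>{..<n} \<times> {..<m}. distr M borel (t p))"
    using assms(1-3) by (subst indep_vars_iff_distr_eq_PiM'[symmetric]) auto
  also have "\<dots> = times_law n m D"
    unfolding times_law_def by (intro PiM_cong refl) (auto simp: D)
  finally show ?thesis ..
qed

text \<open>
  The two expectations under \<^const>\<open>times_law\<close> are the expectations over any probability space
  carrying independent processing times with the prescribed distributions.
\<close>

lemma (in prob_space) expected_times_law:
  assumes nm: "n > 0" "m > 0"
    and ind: "indep_vars (\<lambda>_. borel) t ({..<n} \<times> {..<m})"
    and D: "\<And>i j. i < n \<Longrightarrow> j < m \<Longrightarrow> distr M borel (t (i, j)) = D j"
  shows "expected_opt n m (times_law n m D) = (\<integral>\<^sup>+ \<omega>. ennreal (opt_makespan n m (\<lambda>p. t p \<omega>)) \<partial>M)"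
    and "expected_vcg n m (times_law n m D) =
      (\<integral>\<^sup>+ \<omega>. (\<integral>\<^sup>+ a. ennreal (makespan n m (\<lambda>p. t p \<omega>) a)
        \<partial>measure_pmf (vcg_allocation n m (\<lambda>p. t p \<omega>))) \<partial>M)"
proof -
  let ?I = "{..<n} \<times> {..<m}"
  have mk: "makespan n m (restrict f ?I) = makespan n m f" for f
    by (auto simp: makespan_def fun_eq_iff intro!: arg_cong[where f = Max] image_cong sum.cong)
  have op: "opt_makespan n m (restrict f ?I) = opt_makespan n m f" for f
    by (simp add: opt_makespan_def mk)
  have fm: "fastest_machines n (restrict f ?I) j = fastest_machines n f j" if "j < m" for f j
  proof -
    have "(\<lambda>i'. restrict f ?I (i', j)) ` {..<n} = (\<lambda>i'. f (i', j)) ` {..<n}"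
      using that by (intro image_cong) auto
    then show ?thesis using that by (auto simp: fastest_machines_def)
  qed
  have vc: "vcg_allocation n m (restrict f ?I) = vcg_allocation n m f" for f
    unfolding vcg_allocation_def by (intro Pi_pmf_cong) (auto simp: fm)
  have [measurable]: "(\<lambda>\<omega>. \<lambda>p\<in>?I. t p \<omega>) \<in> M \<rightarrow>\<^sub>M (\<Pi>\<^sub>M p\<in>?I. borel)"
    using ind by (intro measurable_restrict) (auto simp: indep_vars_def)
  have law: "times_law n m D = distr M (\<Pi>\<^sub>M p\<in>?I. borel) (\<lambda>\<omega>. \<lambda>p\<in>?I. t p \<omega>)"
    using nm ind D by (rule times_law_distr)
  note [measurable] = measurable_opt_makespan measurable_vcg_inner[OF nm(1)]
  show "expected_opt n m (times_law n m D) = (\<integral>\<^sup>+ \<omega>. ennreal (opt_makespan n m (\<lambda>p. t p \<omega>)) \<partial>M)"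
    unfolding expected_opt_def law
    by (subst nn_integral_distr) (auto simp: op)
  show "expected_vcg n m (times_law n m D) =
      (\<integral>\<^sup>+ \<omega>. (\<integral>\<^sup>+ a. ennreal (makespan n m (\<lambda>p. t p \<omega>) a)
        \<partial>measure_pmf (vcg_allocation n m (\<lambda>p. t p \<omega>))) \<partial>M)"
    unfolding expected_vcg_def law
    by (subst nn_integral_distr) (auto simp: mk vc)
qed

end

theory Submission
  imports Defs
begin

text \<open>
  Write \<open>T\<^sub>j = min\<^sub>i t\<^sub>i\<^sub>j\<close>. Exchanging two machines in a single column preserves both the law of \<open>t\<close> and
  \<open>T\<close>, so in expectation VCG throws weights \<open>T\<^sub>j\<close> uniformly and independently into \<open>n\<close> bins. On the
  other hand \<open>OPT \<ge> T\<^sub>j\<close> for each \<open>j\<close> and \<open>n OPT \<ge> \<Sum>\<^sub>j T\<^sub>j\<close>. Hence, in units of \<open>OPT\<close>, each bin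
  load is a sum of independent variables in \<open>[0, 1]\<close> of total mean at most \<open>1\<close>, and the exponential
  moment method with parameter \<open>\<lambda> = ln ln n\<close> bounds the expected maximal load by
  \<open>(ln n + exp \<lambda> - 1) / \<lambda> \<le> 2 ln n / ln ln n\<close>.
\<close>

section \<open>Weighted balls in bins\<close>

text \<open>Convexity of \<open>exp\<close>: on the segment from 0 to \<open>l\<close> the graph
  lies below its chord. This makes the exponential moment of a variable in [0, 1] linear in its
  mean.\<close>

lemma exp_mult_le_chord:
  fixes l x :: real
  assumes "0 \<le> x" "x \<le> 1"
  shows "exp (l * x) \<le> 1 + x * (exp l - 1)"
  using convex_onD[OF exp_convex, of x 0 l] assms by (simp add: algebra_simps)

text \<open>Up to the factor \<open>n ^ m\<close>, the left side is the moment generating function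
  of the load of bin \<open>i\<close> under a uniform assignment. It factors over the tasks; the
  chord bound and then 1 + y \<le> \<open>exp y\<close> give a Poisson-type estimate that depends
  only on the total weight.\<close>

lemma sum_exp_load_le:
  fixes w :: "nat \<Rightarrow> real" and l L :: real
  assumes "L > 0" "l \<ge> 0" "i < n"
    and w: "\<And>j. j < m \<Longrightarrow> 0 \<le> w j" "\<And>j. j < m \<Longrightarrow> w j \<le> L"
    and total: "(\<Sum>j<m. w j) \<le> real n * L"
  shows "(\<Sum>a\<in>{..<m} \<rightarrow>\<^sub>E {..<n}. exp (l / L * (\<Sum>j | j < m \<and> a j = i. w j)))
    \<le> real n ^ m * exp (exp l - 1)"
proof -
  have n: "real n > 0" using assms(3) by simp
  have "exp (l / L * (\<Sum>j | j < m \<and> a j = i. w j))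
      = (\<Prod>j<m. if a j = i then exp (l * (w j / L)) else 1)" for a
  proof -
    have "l / L * (\<Sum>j | j < m \<and> a j = i. w j) = (\<Sum>j | j < m \<and> a j = i. l * (w j / L))"
      by (simp add: sum_distrib_left)
    also have "\<dots> = (\<Sum>j<m. if a j = i then l * (w j / L) else 0)"
      by (simp add: sum.If_cases Int_def)
    finally show ?thesis by (auto simp: exp_sum intro!: prod.cong)
  qed
  then have "(\<Sum>a\<in>{..<m} \<rightarrow>\<^sub>E {..<n}. exp (l / L * (\<Sum>j | j < m \<and> a j = i. w j)))
      = (\<Prod>j<m. \<Sum>k<n. if k = i then exp (l * (w j / L)) else 1)"
    by (simp add: prod_sum_PiE)
  \<comment> \<open>The \<open>n - 1\<close> machines other than \<open>i\<close> contribute 1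
    each.\<close>
  also have "\<dots> = (\<Prod>j<m. real n - 1 + exp (l * (w j / L)))"
    using assms(3)
    by (intro prod.cong refl)
       (simp add: sum.remove[of "{..<n}" i] of_nat_diff)
  also have "\<dots> \<le> (\<Prod>j<m. real n * exp (w j / L * (exp l - 1) / n))"
  proof (intro prod_mono conjI)
    fix j assume "j \<in> {..<m}"
    then have x: "0 \<le> w j / L" "w j / L \<le> 1" using w assms(1) by auto
    show "0 \<le> real n - 1 + exp (l * (w j / L))"
      using assms(3) by (intro add_nonneg_nonneg) auto
    have "real n - 1 + exp (l * (w j / L)) \<le> real n * (1 + w j / L * (exp l - 1) / n)"
      using exp_mult_le_chord[OF x, of l] n by (simp add: distrib_left)
    also have "\<dots> \<le> real n * exp (w j / L * (exp l - 1) / n)"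
      using n by (intro mult_left_mono exp_ge_add_one_self) auto
    finally show "real n - 1 + exp (l * (w j / L)) \<le> real n * exp (w j / L * (exp l - 1) / n)" .
  qed
  also have "\<dots> = real n ^ m * exp ((\<Sum>j<m. w j) / (real n * L) * (exp l - 1))"
  proof -
    have "(\<Sum>j<m. w j / L * (exp l - 1) / n) = (\<Sum>j<m. w j) / (real n * L) * (exp l - 1)"
      unfolding sum_divide_distrib sum_distrib_right by (simp add: mult_ac)
    then show ?thesis by (simp add: prod.distrib exp_sum[symmetric])
  qed
  also have "\<dots> \<le> real n ^ m * exp (1 * (exp l - 1))"
    using total n assms(1,2) by (intro mult_left_mono iffD2[OF exp_le_cancel_iff] mult_right_mono) auto
  finally show ?thesis by simp
qed

lemma ln_gt_1:
  assumes "n \<ge> 3"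
  shows "1 < ln (real n)"
proof -
  note ln3_gt_1
  also have "ln 3 \<le> ln (real n)" using assms by simp
  finally show ?thesis .
qed

text \<open>The concave \<open>ln\<close> lies below its tangent at \<open>c\<close>. Averaging this
  inequality, with \<open>c\<close> bounding the mean of \<open>x\<close>, replaces Jensen's
  inequality.\<close>

lemma ln_le_tangent:
  fixes x c :: real
  assumes "x > 0" "c > 0"
  shows "ln x \<le> x / c - 1 + ln c"
  using ln_le_minus_one[of "x / c"] assms by (simp add: ln_div)

text \<open>The exponential of the scaled maximal load is at most the sum \<open>S\<close> of the
  exponentials of all scaled loads. Taking logarithms and averaging over all assignments bounds the
  mean makespan by \<open>L / l * ln c\<close>.\<close>

lemma sum_makespan_weights_le:
  fixes w :: "nat \<Rightarrow> real"
  assumes n: "n \<ge> 3"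
    and w: "\<And>j. j < m \<Longrightarrow> 0 \<le> w j" "\<And>j. j < m \<Longrightarrow> w j \<le> L"
    and total: "(\<Sum>j<m. w j) \<le> real n * L"
    and L: "L \<ge> 0"
  shows "(\<Sum>a\<in>{..<m} \<rightarrow>\<^sub>E {..<n}. makespan n m (\<lambda>(i, j). w j) a)
    \<le> real n ^ m * (2 * (ln n / ln (ln n)) * L)"
proof (cases "L = 0")
  \<comment> \<open>Loads are measured in units of \<open>L\<close> below, so this degenerate case
    is treated apart.\<close>
  case True
  then have "w j = 0" if "j < m" for j using w[OF that] by simp
  then have "(\<Sum>j | j < m \<and> a j = i. w j) = 0" for a :: "nat \<Rightarrow> nat" and i
    by (intro sum.neutral) auto
  then have "makespan n m (\<lambda>(i, j). w j) a = 0" for a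
    using n by (simp add: makespan_def image_constant_conv lessThan_empty_iff)
  then show ?thesis using True by simp
next
  case False
  then have L: "L > 0" using L by simp
  let ?A = "{..<m} \<rightarrow>\<^sub>E {..<n}"
  \<comment> \<open>This choice makes \<open>exp l\<close> equal to \<open>ln n\<close>, so that
    both terms of the bound \<open>ln n + exp l - 1\<close> have the same order.\<close>
  define l where "l = ln (ln (real n))"
  have ln_n: "ln (real n) > 1" using n by (rule ln_gt_1)
  then have l: "l > 0" by (simp add: l_def)
  have exp_l: "exp l = ln n" using ln_n by (simp add: l_def)
  \<comment> \<open>\<open>c\<close> bounds the mean of \<open>S\<close>, by
    \<open>sum_exp_load_le\<close> for each of the \<open>n\<close> bins; with the tangent taken
    there, the average of \<open>S a / c - 1\<close> is at most 0.\<close>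
  define c where "c = real n * exp (exp l - 1)"
  have c: "c > 0" using n by (simp add: c_def)
  have ln_c: "ln c = 2 * ln n - 1" using n by (simp add: c_def ln_mult exp_l)
  define S where "S a = (\<Sum>i<n. exp (l / L * (\<Sum>j | j < m \<and> a j = i. w j)))" for a
  have "l / L * makespan n m (\<lambda>(i, j). w j) a \<le> S a / c - 1 + ln c" for a
  proof -
    have "makespan n m (\<lambda>(i, j). w j) a \<in> (\<lambda>i. \<Sum>j | j < m \<and> a j = i. w j) ` {..<n}"
      unfolding makespan_def prod.case using n by (intro Max_in) (auto simp: lessThan_empty_iff)
    then obtain i where i: "i < n"
      "makespan n m (\<lambda>(i, j). w j) a = (\<Sum>j | j < m \<and> a j = i. w j)" by auto
    have S: "exp (l / L * makespan n m (\<lambda>(i, j). w j) a) \<le> S a"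
      unfolding S_def i(2) using i(1) by (intro member_le_sum) auto
    then have "l / L * makespan n m (\<lambda>(i, j). w j) a \<le> ln (S a)"
      by (subst ln_ge_iff) (auto intro: less_le_trans[OF exp_gt_zero])
    also have "\<dots> \<le> S a / c - 1 + ln c"
      using S c by (intro ln_le_tangent) (auto intro: less_le_trans[OF exp_gt_zero])
    finally show ?thesis .
  qed
  then have "(\<Sum>a\<in>?A. l / L * makespan n m (\<lambda>(i, j). w j) a) \<le> (\<Sum>a\<in>?A. S a / c - 1 + ln c)"
    by (intro sum_mono)
  also have "\<dots> = (\<Sum>a\<in>?A. S a) / c + real n ^ m * (ln c - 1)"
    by (simp add: sum.distrib sum_subtractf sum_divide_distrib card_PiE algebra_simps)
  also have "(\<Sum>a\<in>?A. S a) \<le> real n ^ m * c"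
  proof -
    have "(\<Sum>a\<in>?A. S a) = (\<Sum>i<n. \<Sum>a\<in>?A. exp (l / L * (\<Sum>j | j < m \<and> a j = i. w j)))"
      unfolding S_def by (rule sum.swap)
    also have "\<dots> \<le> (\<Sum>i<n. real n ^ m * exp (exp l - 1))"
      using L l w total by (intro sum_mono sum_exp_load_le) auto
    finally show ?thesis by (simp add: c_def mult_ac)
  qed
  then have "(\<Sum>a\<in>?A. S a) / c + real n ^ m * (ln c - 1) \<le> real n ^ m * ln c"
    using c by (simp add: field_simps)
  also have "\<dots> \<le> real n ^ m * (2 * ln n)"
    by (intro mult_left_mono) (auto simp: ln_c)
  finally have "l / L * (\<Sum>a\<in>?A. makespan n m (\<lambda>(i, j). w j) a) \<le> real n ^ m * (2 * ln n)"
    by (simp only: sum_distrib_left)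
  then show ?thesis
    using L l by (simp add: l_def[symmetric] field_simps)
qed

section \<open>Lower bounds on the optimal makespan\<close>

text \<open>The value does not depend on the machine; it is kept as a matrix so that
  \<open>makespan\<close> applies to it.\<close>

definition min_times :: "nat \<Rightarrow> (nat \<times> nat \<Rightarrow> real) \<Rightarrow> nat \<times> nat \<Rightarrow> real" where
  "min_times n t = (\<lambda>(i, j). Min ((\<lambda>i'. t (i', j)) ` {..<n}))"

lemma min_times_le: "i < n \<Longrightarrow> min_times n t (k, j) \<le> t (i, j)"
  by (auto simp: min_times_def)

lemma min_times_nonneg:
  assumes "n > 0" "\<And>i. i < n \<Longrightarrow> 0 \<le> t (i, j)"
  shows "0 \<le> min_times n t (k, j)"
proof -
  have "min_times n t (k, j) \<in> (\<lambda>i. t (i, j)) ` {..<n}"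
    unfolding min_times_def prod.case using assms(1) by (intro Min_in) auto
  then show ?thesis using assms(2) by auto
qed

lemma load_le_makespan: "i < n \<Longrightarrow> (\<Sum>j | j < m \<and> a j = i. t (i, j)) \<le> makespan n m t a"
  by (auto simp: makespan_def)

lemma opt_makespan_obtain:
  assumes "n > 0"
  obtains a where "a \<in> {..<m} \<rightarrow>\<^sub>E {..<n}" "opt_makespan n m t = makespan n m t a"
proof -
  have "opt_makespan n m t \<in> makespan n m t ` ({..<m} \<rightarrow>\<^sub>E {..<n})"
    unfolding opt_makespan_def using assms
    by (intro Min_in) (auto intro: finite_PiE simp: PiE_eq_empty_iff)
  then show ?thesis using that by auto
qed

text \<open>The machine that runs \<open>j\<close> in an optimal assignment carries at least the
  time of \<open>j\<close>, as its other times are nonnegative.\<close>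

lemma min_times_le_opt_makespan:
  assumes "n > 0" "j < m" and t: "\<And>i j. i < n \<Longrightarrow> j < m \<Longrightarrow> 0 \<le> t (i, j)"
  shows "min_times n t (k, j) \<le> opt_makespan n m t"
proof -
  obtain a where a: "a \<in> {..<m} \<rightarrow>\<^sub>E {..<n}" "opt_makespan n m t = makespan n m t a"
    using opt_makespan_obtain[OF assms(1)] .
  have aj: "a j < n" using a(1) assms(2) by auto
  have "min_times n t (k, j) \<le> t (a j, j)" using aj by (rule min_times_le)
  also have "\<dots> \<le> (\<Sum>j' | j' < m \<and> a j' = a j. t (a j, j'))"
    using assms(2) t aj by (intro member_le_sum[of j _ "\<lambda>j'. t (a j, j')"]) auto
  also have "\<dots> \<le> makespan n m t a" using aj by (rule load_le_makespan)
  finally show ?thesis using a(2) by simp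
qed

text \<open>Regroup the total work of an optimal assignment by machine: each of the \<open>n\<close>
  loads is at most the makespan.\<close>

lemma sum_min_times_le_opt_makespan:
  assumes "n > 0"
  shows "(\<Sum>j<m. min_times n t (k, j)) \<le> real n * opt_makespan n m t"
proof -
  obtain a where a: "a \<in> {..<m} \<rightarrow>\<^sub>E {..<n}" "opt_makespan n m t = makespan n m t a"
    using opt_makespan_obtain[OF assms] .
  have "(\<Sum>j<m. min_times n t (k, j)) \<le> (\<Sum>j<m. t (a j, j))"
    using a(1) by (intro sum_mono min_times_le) auto
  also have "\<dots> = (\<Sum>i<n. \<Sum>j | j \<in> {..<m} \<and> a j = i. t (a j, j))"
    using a(1) by (intro sum.group[symmetric]) auto
  also have "\<dots> = (\<Sum>i<n. \<Sum>j | j < m \<and> a j = i. t (i, j))"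
    by (intro sum.cong) auto
  also have "\<dots> \<le> (\<Sum>i<n. makespan n m t a)"
    by (intro sum_mono load_le_makespan) auto
  finally show ?thesis using a(2) by simp
qed

lemma sum_makespan_min_times_le:
  assumes n: "n \<ge> 3" "m > 0" and t: "\<And>i j. i < n \<Longrightarrow> j < m \<Longrightarrow> 0 \<le> t (i, j)"
  shows "(\<Sum>a\<in>{..<m} \<rightarrow>\<^sub>E {..<n}. makespan n m (min_times n t) a)
    \<le> real n ^ m * (2 * (ln n / ln (ln n)) * opt_makespan n m t)"
proof -
  let ?w = "\<lambda>j. min_times n t (0, j)"
  have eq: "min_times n t = (\<lambda>(i, j). ?w j)" by (auto simp: min_times_def)
  have w: "0 \<le> ?w j" "?w j \<le> opt_makespan n m t" if "j < m" for j
  proof -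
    show "0 \<le> ?w j" using n t that by (intro min_times_nonneg) auto
    show "?w j \<le> opt_makespan n m t" using n t that by (intro min_times_le_opt_makespan) auto
  qed
  \<comment> \<open>Since \<open>m > 0\<close>, task 0 exists and its weight lies between 0 and the
    optimum.\<close>
  have "0 \<le> opt_makespan n m t" using w[OF n(2)] by simp
  then show ?thesis
    using w n(1) sum_min_times_le_opt_makespan[of n t 0 m]
    by (subst eq, intro sum_makespan_weights_le) auto
qed

section \<open>Exchanging machines within a column\<close>

text \<open>For \<open>n > 0\<close> this is the mass of an extensional assignment under
  \<open>vcg_allocation\<close>, in the form produced by \<open>vcg_inner_eq_sum\<close>.\<close>

definition vcg_prob :: "nat \<Rightarrow> nat \<Rightarrow> (nat \<times> nat \<Rightarrow> real) \<Rightarrow> (nat \<Rightarrow> nat) \<Rightarrow> real" where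
  "vcg_prob n m t a =
     (\<Prod>j<m. indicator (fastest_machines n t j) (a j) / real (card (fastest_machines n t j)))"

lemma vcg_prob_nonneg: "0 \<le> vcg_prob n m t a"
  by (auto simp: vcg_prob_def intro!: prod_nonneg)

lemma sum_vcg_prob:
  assumes "n > 0"
  shows "(\<Sum>a\<in>{..<m} \<rightarrow>\<^sub>E {..<n}. vcg_prob n m t a) = 1"
proof -
  have "(\<Sum>i<n. indicator (fastest_machines n t j) i / real (card (fastest_machines n t j))) = (1::real)"
    for j
  proof -
    have "{..<n} \<inter> fastest_machines n t j = fastest_machines n t j"
      by (auto simp: fastest_machines_def)
    moreover have "card (fastest_machines n t j) > 0"
      using fastest_machines_nonempty[OF assms] fastest_machines_finite by (simp add: card_gt_0_iff)
    ultimately show ?thesis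
      by (simp add: sum_divide_distrib[symmetric] indicator_def sum.If_cases)
  qed
  then show ?thesis unfolding vcg_prob_def by (subst prod_sum_PiE[symmetric]) auto
qed

text \<open>If \<open>a\<close> uses only fastest machines, the times it incurs are the column
  minima; otherwise both sides vanish.\<close>

lemma makespan_min_times_vcg_prob:
  "ennreal (makespan n m t a) * ennreal (vcg_prob n m t a)
    = ennreal (makespan n m (min_times n t) a) * ennreal (vcg_prob n m t a)"
proof (cases "\<forall>j<m. a j \<in> fastest_machines n t j")
  case True
  then have "t (a j, j) = min_times n t (a j, j)" if "j < m" for j
    using that by (simp add: fastest_machines_def min_times_def)
  then have "makespan n m t a = makespan n m (min_times n t) a"
    unfolding makespan_def by (auto intro!: arg_cong[where f = Max] image_cong sum.cong)
  then show ?thesis by simp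
next
  case False
  then have "vcg_prob n m t a = 0" by (auto simp: vcg_prob_def intro!: prod_zero bexI)
  then show ?thesis by simp
qed

text \<open>Column \<open>j\<close> has its rows \<open>a j\<close> and \<open>b j\<close> swapped.
  The restriction keeps the result extensional, as the product space requires.\<close>

definition exchange ::
    "nat \<Rightarrow> nat \<Rightarrow> (nat \<Rightarrow> nat) \<Rightarrow> (nat \<Rightarrow> nat) \<Rightarrow> (nat \<times> nat \<Rightarrow> real) \<Rightarrow> nat \<times> nat \<Rightarrow> real" where
  "exchange n m a b t =
     (\<lambda>p\<in>{..<n} \<times> {..<m}. t (Transposition.transpose (a (snd p)) (b (snd p)) (fst p), snd p))"

lemma transpose_lessThan:
  "x < n \<Longrightarrow> y < n \<Longrightarrow> Transposition.transpose x y i < n \<longleftrightarrow> i < (n::nat)"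
  by (auto simp: Transposition.transpose_def)

lemma transpose_image_lessThan:
  "x < n \<Longrightarrow> y < n \<Longrightarrow> Transposition.transpose x y ` {..<n} = {..<n::nat}"
  by (auto simp: transpose_lessThan intro!: image_eqI[of _ _ "Transposition.transpose x y _"])

context
  fixes n m :: nat and a b :: "nat \<Rightarrow> nat"
  assumes a: "a \<in> {..<m} \<rightarrow>\<^sub>E {..<n}" and b: "b \<in> {..<m} \<rightarrow>\<^sub>E {..<n}"
begin

lemma ab_less: "j < m \<Longrightarrow> a j < n" "j < m \<Longrightarrow> b j < n"
  using a b by auto

lemma exchange_column_image:
  assumes "j < m"
  shows "(\<lambda>i. exchange n m a b t (i, j)) ` {..<n} = (\<lambda>i. t (i, j)) ` {..<n}"
proof -
  have "(\<lambda>i. exchange n m a b t (i, j)) ` {..<n} = (\<lambda>i. t (i, j))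
      ` Transposition.transpose (a j) (b j) ` {..<n}"
    using assms by (force simp: exchange_def)
  then show ?thesis using ab_less[OF assms] by (simp add: transpose_image_lessThan)
qed

lemma makespan_min_times_exchange:
  "makespan n m (min_times n (exchange n m a b t)) c = makespan n m (min_times n t) c"
  unfolding makespan_def min_times_def
  by (auto simp: exchange_column_image intro!: arg_cong[where f = Max] image_cong sum.cong)

lemma fastest_machines_exchange:
  assumes "j < m"
  shows "i \<in> fastest_machines n (exchange n m a b t) j
    \<longleftrightarrow> Transposition.transpose (a j) (b j) i \<in> fastest_machines n t j"
  using assms ab_less[OF assms] exchange_column_image[OF assms, of t]
  by (auto simp: fastest_machines_def transpose_lessThan exchange_def)

lemma card_fastest_machines_exchange:
  assumes "j < m"
  shows "card (fastest_machines n (exchange n m a b t) j) = card (fastest_machines n t j)"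
proof -
  have "fastest_machines n (exchange n m a b t) j
      = Transposition.transpose (a j) (b j) ` fastest_machines n t j"
    using fastest_machines_exchange[OF assms]
    by (auto intro!: image_eqI[of _ _ "Transposition.transpose (a j) (b j) _"])
  then show ?thesis by (simp add: card_image)
qed

text \<open>The transposition sends \<open>a j\<close> to \<open>b j\<close>, so \<open>a j\<close>
  is fastest after the exchange iff \<open>b j\<close> was before; the number of ties in a column is
  unchanged.\<close>

lemma vcg_prob_exchange: "vcg_prob n m (exchange n m a b t) a = vcg_prob n m t b"
  unfolding vcg_prob_def
  by (intro prod.cong refl arg_cong2[where f = "(/)"])
     (auto simp: card_fastest_machines_exchange fastest_machines_exchange indicator_def)

text \<open>Coordinates move only within their column, where all have the same law. This is where
  the machines being a priori identical enters.\<close>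

lemma times_law_exchange:
  assumes D: "\<And>j. j < m \<Longrightarrow> prob_space (D j)"
  shows "distr (times_law n m D) (times_law n m D) (exchange n m a b) = times_law n m D"
proof -
  let ?I = "{..<n} \<times> {..<m}"
  let ?f = "\<lambda>p. (Transposition.transpose (a (snd p)) (b (snd p)) (fst p), snd p)"
  have "inj_on ?f ?I"
    by (auto simp: inj_on_def) (metis transpose_involutory)
  moreover have "?f \<in> ?I \<rightarrow> ?I"
    using ab_less by (auto simp: transpose_lessThan)
  ultimately have "distr (\<Pi>\<^sub>M p\<in>?I. D (snd p)) (\<Pi>\<^sub>M p\<in>?I. D (snd (?f p))) (\<lambda>t. \<lambda>p\<in>?I. t (?f p))
      = (\<Pi>\<^sub>M p\<in>?I. D (snd (?f p)))"
    using D by (intro distr_PiM_reindex) auto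
  then show ?thesis
    unfolding times_law_def exchange_def[abs_def] by simp
qed

lemma measurable_exchange:
  "exchange n m a b \<in> times_law n m D \<rightarrow>\<^sub>M times_law n m D"
  unfolding exchange_def[abs_def] times_law_def
proof (intro measurable_restrict)
  fix p assume "p \<in> {..<n} \<times> {..<m}"
  then show "(\<lambda>t. t (Transposition.transpose (a (snd p)) (b (snd p)) (fst p), snd p))
      \<in> (\<Pi>\<^sub>M p\<in>{..<n} \<times> {..<m}. D (snd p)) \<rightarrow>\<^sub>M D (snd p)"
    using ab_less
      measurable_component_singleton[of "(Transposition.transpose (a (snd p)) (b (snd p)) (fst p), snd p)"
        "{..<n} \<times> {..<m}" "\<lambda>p. D (snd p)"]
    by (auto simp: transpose_lessThan)
qed

end

section \<open>Reduction of VCG to uniform assignments\<close>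

lemma measurable_min_times:
  "j < m \<Longrightarrow> (\<lambda>t. min_times n t (i, j)) \<in> borel_measurable (\<Pi>\<^sub>M p\<in>{..<n} \<times> {..<m}. borel)"
  unfolding min_times_def prod.case
  by (intro borel_measurable_Min finite_lessThan measurable_component_singleton) auto

lemma measurable_vcg_prob:
  "(\<lambda>t. vcg_prob n m t a) \<in> borel_measurable (\<Pi>\<^sub>M p\<in>{..<n} \<times> {..<m}. borel)"
    (is "_ \<in> borel_measurable ?B")
proof -
  have ind: "(\<lambda>t. indicator (fastest_machines n t j) i :: real) \<in> borel_measurable ?B"
    if "j < m" for i j
  proof (cases "i < n")
    case True
    then have "(\<lambda>t. t (i, j)) \<in> borel_measurable ?B"
      using that by (intro measurable_component_singleton) auto
    from borel_measurable_eq[OF this measurable_min_times[OF that, of n 0]]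
    have [measurable]: "Measurable.pred ?B (\<lambda>t. i \<in> fastest_machines n t j)"
      using True by (simp add: fastest_machines_def min_times_def pred_def)
    show ?thesis unfolding indicator_def by measurable
  qed (simp add: fastest_machines_def)
  have "real (card (fastest_machines n t j)) = (\<Sum>i<n. indicator (fastest_machines n t j) i)" for t j
    by (auto simp: fastest_machines_def indicator_def sum.If_cases intro!: arg_cong[where f = card])
  then show ?thesis unfolding vcg_prob_def using ind
    by (auto intro!: borel_measurable_prod borel_measurable_divide borel_measurable_sum)
qed

lemma measurable_makespan_min_times:
  "(\<lambda>t. makespan n m (min_times n t) a) \<in> borel_measurable (\<Pi>\<^sub>M p\<in>{..<n} \<times> {..<m}. borel)"
  unfolding makespan_def
  by (intro borel_measurable_Max finite_lessThan borel_measurable_sum measurable_min_times) auto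

text \<open>By exchange symmetry the weight of \<open>a\<close> may be replaced by that of any
  \<open>b\<close>; summed over \<open>b\<close>, these weights give 1. Multiplying by
  \<open>n ^ m\<close> avoids division in \<open>ennreal\<close>.\<close>

lemma expected_vcg_eq_uniform:
  assumes n: "n > 0" and D: "\<And>j. j < m \<Longrightarrow> real_distribution (D j)"
  shows "of_nat (n ^ m) * expected_vcg n m (times_law n m D)
    = (\<integral>\<^sup>+ t. (\<Sum>a\<in>{..<m} \<rightarrow>\<^sub>E {..<n}. ennreal (makespan n m (min_times n t) a)) \<partial>times_law n m D)"
proof -
  let ?A = "{..<m} \<rightarrow>\<^sub>E {..<n}" and ?P = "times_law n m D"
  let ?M = "\<lambda>t a. ennreal (makespan n m (min_times n t) a)"
  let ?W = "\<lambda>t a. ennreal (vcg_prob n m t a)"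
  have sets: "sets ?P = sets (\<Pi>\<^sub>M p\<in>{..<n} \<times> {..<m}. borel)"
    unfolding times_law_def using D by (intro sets_PiM_cong) (auto simp: real_distribution.events_eq_borel)
  note [measurable_cong] = sets
  note [measurable] = measurable_vcg_prob measurable_makespan_min_times
  have swap: "(\<integral>\<^sup>+ t. ?M t a * ?W t a \<partial>?P) = (\<integral>\<^sup>+ t. ?M t a * ?W t b \<partial>?P)"
    if ab: "a \<in> ?A" "b \<in> ?A" for a b
  proof -
    note [measurable] = measurable_exchange[OF ab]
    have "(\<integral>\<^sup>+ t. ?M t a * ?W t a \<partial>?P)
        = (\<integral>\<^sup>+ t. ?M t a * ?W t a \<partial>distr ?P ?P (exchange n m a b))"
      using D by (subst times_law_exchange[OF ab]) (auto simp: real_distribution_def)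
    also have "\<dots> = (\<integral>\<^sup>+ t. ?M (exchange n m a b t) a * ?W (exchange n m a b t) a \<partial>?P)"
      by (intro nn_integral_distr) measurable
    finally show ?thesis
      by (simp add: makespan_min_times_exchange[OF ab] vcg_prob_exchange[OF ab])
  qed
  have card: "(of_nat (n ^ m) :: ennreal) = of_nat (card ?A)" by (simp add: card_PiE)
  have "expected_vcg n m ?P = (\<integral>\<^sup>+ t. (\<Sum>a\<in>?A. ?M t a * ?W t a) \<partial>?P)"
    unfolding expected_vcg_def vcg_inner_eq_sum[OF n] vcg_prob_def[symmetric]
    by (simp add: makespan_min_times_vcg_prob)
  also have "\<dots> = (\<Sum>a\<in>?A. \<integral>\<^sup>+ t. ?M t a * ?W t a \<partial>?P)"
    by (intro nn_integral_sum) measurable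
  \<comment> \<open>The factor \<open>n ^ m\<close> is spent as a sum over a dummy \<open>b\<close>,
    to which \<open>swap\<close> then applies.\<close>
  finally have "of_nat (n ^ m) * expected_vcg n m ?P
      = (\<Sum>a\<in>?A. \<Sum>b\<in>?A. \<integral>\<^sup>+ t. ?M t a * ?W t a \<partial>?P)"
    unfolding card by (simp add: sum_distrib_left)
  also have "\<dots> = (\<Sum>a\<in>?A. \<Sum>b\<in>?A. \<integral>\<^sup>+ t. ?M t a * ?W t b \<partial>?P)"
    by (intro sum.cong refl swap)
  also have "\<dots> = (\<Sum>a\<in>?A. \<integral>\<^sup>+ t. (\<Sum>b\<in>?A. ?M t a * ?W t b) \<partial>?P)"
    by (subst nn_integral_sum) measurable
  also have "\<dots> = (\<Sum>a\<in>?A. \<integral>\<^sup>+ t. ?M t a \<partial>?P)"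
    by (simp add: sum_distrib_left[symmetric] sum_vcg_prob[OF n] vcg_prob_nonneg)
  also have "\<dots> = (\<integral>\<^sup>+ t. (\<Sum>a\<in>?A. ?M t a) \<partial>?P)"
    by (subst nn_integral_sum) measurable
  finally show ?thesis .
qed

section \<open>Almost sure nonnegativity and the final comparison\<close>

lemma times_law_AE_nonneg:
  assumes D: "\<And>j. j < m \<Longrightarrow> prob_space (D j)" "\<And>j. j < m \<Longrightarrow> AE x in D j. 0 \<le> x"
  shows "AE t in times_law n m D. \<forall>i<n. \<forall>j<m. 0 \<le> t (i, j)"
proof -
  have "AE t in times_law n m D. 0 \<le> t p" if "p \<in> {..<n} \<times> {..<m}" for p
    unfolding times_law_def using D that by (intro AE_PiM_component) auto
  then have "AE t in times_law n m D. \<forall>p\<in>{..<n} \<times> {..<m}. 0 \<le> t p"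
    by (intro AE_finite_allI) auto
  then show ?thesis by (rule AE_mp) auto
qed

theorem theorem4:
  shows "\<exists>C::real. C > 0 \<and>
    (\<forall>(n::nat) (m::nat) (D :: nat \<Rightarrow> real measure).
       n \<ge> 3 \<longrightarrow> m \<ge> n \<longrightarrow>
       (\<forall>j<m. real_distribution (D j) \<and> (AE x in D j. 0 \<le> x)) \<longrightarrow>
       expected_vcg n m (times_law n m D)
         \<le> ennreal (C * (ln (real n) / ln (ln (real n)))) * expected_opt n m (times_law n m D))"
proof (intro exI[of _ 2] conjI allI impI)
  fix n m :: nat and D :: "nat \<Rightarrow> real measure"
  assume n: "n \<ge> 3" and m: "m \<ge> n"
    and D: "\<forall>j<m. real_distribution (D j) \<and> (AE x in D j. 0 \<le> x)"
  let ?A = "{..<m} \<rightarrow>\<^sub>E {..<n}" and ?P = "times_law n m D"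
  \<comment> \<open>The constant 2 stems from \<open>ln c \<le> 2 * ln n\<close> in
    \<open>sum_makespan_weights_le\<close>.\<close>
  let ?r = "2 * (ln (real n) / ln (ln (real n)))"
  have r: "?r \<ge> 0" using ln_gt_1[OF n] by simp
  have sets: "sets ?P = sets (\<Pi>\<^sub>M p\<in>{..<n} \<times> {..<m}. borel)"
    unfolding times_law_def using D by (intro sets_PiM_cong) (auto simp: real_distribution.events_eq_borel)
  note [measurable_cong] = sets
  note [measurable] = measurable_opt_makespan
  have nonneg: "AE t in ?P. \<forall>i<n. \<forall>j<m. 0 \<le> t (i, j)"
    using D by (intro times_law_AE_nonneg) (auto simp: real_distribution_def)
  have "of_nat (n ^ m) * expected_vcg n m ?P
      = (\<integral>\<^sup>+ t. (\<Sum>a\<in>?A. ennreal (makespan n m (min_times n t) a)) \<partial>?P)"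
    using n D by (intro expected_vcg_eq_uniform) auto
  also have "\<dots> \<le> (\<integral>\<^sup>+ t. of_nat (n ^ m) * ennreal ?r * ennreal (opt_makespan n m t) \<partial>?P)"
  proof (rule nn_integral_mono_AE, use nonneg in eventually_elim)
    case (elim t)
    \<comment> \<open>Nonnegativity lets the coercion to \<open>ennreal\<close> commute with the sum
      over assignments.\<close>
    have mk: "0 \<le> makespan n m (min_times n t) a" for a
    proof -
      have "0 \<le> min_times n t (0, j)" if "j < m" for j
        using elim that n by (intro min_times_nonneg) auto
      then have "0 \<le> (\<Sum>j | j < m \<and> a j = 0. min_times n t (0, j))"
        by (intro sum_nonneg) auto
      also have "\<dots> \<le> makespan n m (min_times n t) a"
        using n by (intro load_le_makespan) auto
      finally show ?thesis .
    qed
    have "(\<Sum>a\<in>?A. ennreal (makespan n m (min_times n t) a))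
        = ennreal (\<Sum>a\<in>?A. makespan n m (min_times n t) a)"
      using mk by (intro sum_ennreal)
    also have "\<dots> \<le> ennreal (real (n ^ m) * (?r * opt_makespan n m t))"
      using sum_makespan_min_times_le[of n m t] n m elim by (intro ennreal_leI) auto
    also have "\<dots> = of_nat (n ^ m) * ennreal ?r * ennreal (opt_makespan n m t)"
      using r by (simp only: ennreal_mult' ennreal_of_nat_eq_real_of_nat mult.assoc of_nat_0_le_iff)
    finally show ?case .
  qed
  also have "\<dots> = of_nat (n ^ m) * (ennreal ?r * expected_opt n m ?P)"
    unfolding expected_opt_def by (subst nn_integral_cmult) (auto simp: mult.assoc)
  finally have *: "of_nat (n ^ m) * expected_vcg n m ?P
      \<le> of_nat (n ^ m) * (ennreal ?r * expected_opt n m ?P)" .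
  \<comment> \<open>Cancelling a factor in \<open>ennreal\<close> requires it to be neither 0 nor
    infinite.\<close>
  have "(of_nat (n ^ m) :: ennreal) \<noteq> 0" "(of_nat (n ^ m) :: ennreal) \<noteq> \<top>"
    using n by (simp, simp add: ennreal_of_nat_neq_top del: of_nat_power)
  with * show "expected_vcg n m ?P \<le> ennreal ?r * expected_opt n m ?P"
    by (simp add: ennreal_mult_le_mult_iff)
qed simp

end
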